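(* Let $m\ge 0$ and $r\ge1$ be integers, assume $n\geq\binom{m+r}{r}-1$, and let $L\subset\mathbb{P}^n$ be a generic linear space of dimension $m$. Consider points $p_i,q_j\in L$ for $1\le i,j\le r$ such that $p_1\star\cdots\star p_r=q_1\star\cdots\star q_r$. Then $\{p_1,\ldots,p_r\}=\{q_1,\ldots,q_r\}$.
   Context: The base field is $\mathbb{C}$. For points $p=[a_0:\dots:a_n]$, $q=[b_0:\dots:b_n]$ of $\mathbb{P}^n$, the Hadamard product $p\star q=[a_0b_0:\dots:a_nb_n]$ is defined when some $a_ib_i\neq0$; $p_1\star\cdots\star p_r$ is the coordinatewise product. "Generic linear space of dimension $m$" means that the statement holds for all $L$ in some non-empty Zariski open subset of the Grassmannian of $m$-dimensional linear subspaces of $\mathbb{P}^n$. *)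

theory Defs
  imports "HOL-Analysis.Analysis" "Jordan_Normal_Form.Determinant"
begin

no_notation Matrix.vec_index (infixl "$" 100)

section \<open>Projective space and Hadamard products\<close>

text \<open>
  If \<^term>\<open>CARD('n) = n + 1\<close>, the type \<open>'n proj\<close> is the projective
  space of dimension \<open>n\<close> over the complex numbers.
\<close>

definition proj_rel :: "complex ^ 'n::finite \<Rightarrow> complex ^ 'n \<Rightarrow> bool" where
  "proj_rel v w \<longleftrightarrow> v \<noteq> 0 \<and> w \<noteq> 0 \<and> (\<exists>c. w = c *s v)"

lemma part_equivp_proj_rel: "part_equivp (proj_rel :: complex ^ 'n::finite \<Rightarrow> _)"
proof (rule part_equivpI)
  have "(\<chi> i. 1) \<noteq> (0 :: complex ^ 'n)"
    by (simp add: Finite_Cartesian_Product.vec_eq_iff)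
  then have "proj_rel (\<chi> i. 1) ((\<chi> i. 1) :: complex ^ 'n)"
    unfolding proj_rel_def by (metis vector_smult_lid)
  then show "\<exists>v. proj_rel v (v :: complex ^ 'n)" by blast
next
  show "symp (proj_rel :: complex ^ 'n \<Rightarrow> _)"
  proof (rule sympI)
    fix v w :: "complex ^ 'n"
    assume "proj_rel v w"
    then obtain c where vw: "v \<noteq> 0" "w \<noteq> 0" "w = c *s v"
      unfolding proj_rel_def by blast
    then have "c \<noteq> 0" by auto
    with vw have "v = inverse c *s w" by (simp add: vector_smult_assoc)
    with vw show "proj_rel w v" unfolding proj_rel_def by blast
  qed
next
  show "transp (proj_rel :: complex ^ 'n \<Rightarrow> _)"
    by (rule transpI) (metis proj_rel_def vector_smult_assoc)
qed

quotient_type 'n proj = "complex ^ ('n::finite)" / partial: proj_rel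
  morphisms rep_proj proj
  by (rule part_equivp_proj_rel)

text \<open>
  \<^term>\<open>proj v\<close> is the point with homogeneous coordinates \<open>v\<close> (for \<open>v \<noteq> 0\<close>), and
  \<^term>\<open>rep_proj p\<close> is some vector of homogeneous coordinates of the point \<open>p\<close>.
\<close>

lemma rep_proj_nonzero: "rep_proj p \<noteq> 0"
  using Quotient_rep_reflp[OF Quotient_proj, of p] by (simp add: proj_rel_def)

lemma proj_rep_proj [simp]: "proj (rep_proj p) = p"
  by (rule Quotient_abs_rep[OF Quotient_proj])

lemma proj_eq_iff:
  assumes "v \<noteq> 0" "w \<noteq> 0"
  shows "proj v = proj w \<longleftrightarrow> (\<exists>c. w = c *s v)"
proof -
  have refl: "proj_rel u u" if "u \<noteq> 0" for u :: "complex ^ 'n"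
    using that unfolding proj_rel_def by (metis vector_smult_lid)
  have "proj_rel v w \<longleftrightarrow> proj v = proj w"
    using Quotient_rel[OF Quotient_proj, of v w] refl assms by blast
  then show ?thesis using assms by (auto simp: proj_rel_def)
qed

text \<open>
  The Hadamard product of a finite family of points; it is undefined (\<^term>\<open>None\<close>) when all the
  coordinatewise products vanish.  By \<open>hadamard_prod_proj\<close> below it does not depend on the
  choice of homogeneous coordinates.
\<close>

definition hadamard_prod :: "'i set \<Rightarrow> ('i \<Rightarrow> ('n::finite) proj) \<Rightarrow> 'n proj option" where
  "hadamard_prod I p =
     (let v = (\<chi> k. \<Prod>i\<in>I. rep_proj (p i) $ k) in if v = 0 then None else Some (proj v))"

lemma hadamard_prod_proj:
  fixes a :: "'i \<Rightarrow> complex ^ 'n::finite"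
  assumes "finite I" and nz: "\<And>i. i \<in> I \<Longrightarrow> a i \<noteq> 0"
  shows "hadamard_prod I (\<lambda>i. proj (a i)) =
    (let v = (\<chi> k. \<Prod>i\<in>I. a i $ k) in if v = 0 then None else Some (proj v))"
proof -
  have "\<exists>c. rep_proj (proj (a i)) = c *s a i" if "i \<in> I" for i
    using proj_eq_iff[OF nz[OF that] rep_proj_nonzero[of "proj (a i)"]] by simp
  then obtain c where c: "\<And>i. i \<in> I \<Longrightarrow> rep_proj (proj (a i)) = c i *s a i"
    by metis
  define v w where "v = (\<chi> k. \<Prod>i\<in>I. a i $ k)"
    and "w = (\<chi> k. \<Prod>i\<in>I. rep_proj (proj (a i)) $ k)"
  have "w = (\<chi> k. \<Prod>i\<in>I. c i * a i $ k)"
    unfolding w_def by (simp add: Finite_Cartesian_Product.vec_eq_iff c)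
  then have w: "w = prod c I *s v"
    by (simp add: v_def vector_scalar_mult_def prod.distrib)
  have "c i \<noteq> 0" if "i \<in> I" for i
    using c[OF that] rep_proj_nonzero[of "proj (a i)"] by auto
  then have "prod c I \<noteq> 0"
    using \<open>finite I\<close> by simp
  then have "w = 0 \<longleftrightarrow> v = 0"
    using w by (simp add: Finite_Cartesian_Product.vec_eq_iff)
  moreover have "proj w = proj v" if "v \<noteq> 0"
    using proj_eq_iff[OF that, of w] that w \<open>w = 0 \<longleftrightarrow> v = 0\<close> by auto
  ultimately show ?thesis
    unfolding hadamard_prod_def Let_def v_def[symmetric] w_def[symmetric] by simp
qed

section \<open>Linear subspaces and the Grassmannian\<close>

definition projectivization :: "(complex ^ 'n::finite) set \<Rightarrow> 'n proj set" where
  "projectivization W = {proj v | v. v \<in> W \<and> v \<noteq> 0}"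

text \<open>The projective dimension \<open>m\<close> corresponds to linear dimension \<open>m + 1\<close>.\<close>

definition grassmannian :: "nat \<Rightarrow> ('n::finite) proj set set" where
  "grassmannian m = {projectivization W | W. vec.subspace W \<and> vec.dim W = Suc m}"

text \<open>
  \<^term>\<open>frame m b\<close>: the vectors \<open>b 0, \<dots>, b m\<close> are linearly independent.
\<close>

definition frame :: "nat \<Rightarrow> (nat \<Rightarrow> complex ^ 'n::finite) \<Rightarrow> bool" where
  "frame m b \<longleftrightarrow> inj_on b {..m} \<and> vec.independent (b ` {..m})"

text \<open>
  Pluecker coordinates of the span of \<open>b 0, \<dots>, b m\<close>: the maximal minors of the matrix with
  these rows.  They are indexed by all sequences \<open>J 0, \<dots>, J m\<close> of columns, not only by the
  increasing ones; the additional coordinates are zero or agree up to sign with the usual ones,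
  so this does not affect zero loci of homogeneous polynomials.
\<close>

definition plucker :: "nat \<Rightarrow> (nat \<Rightarrow> complex ^ 'n::finite) \<Rightarrow> (nat \<Rightarrow> 'n) \<Rightarrow> complex" where
  "plucker m b J = Determinant.det (Matrix.mat (Suc m) (Suc m) (\<lambda>(i, j). b i $ J j))"

text \<open>
  Homogeneous polynomials of degree \<open>d\<close> in variables indexed by \<open>'v\<close>, viewed as functions
  (over the infinite field of complex numbers nothing is lost by this).
\<close>

inductive homogeneous_poly :: "nat \<Rightarrow> (('v \<Rightarrow> complex) \<Rightarrow> complex) \<Rightarrow> bool" where
  const: "homogeneous_poly 0 (\<lambda>x. c)"
| var: "homogeneous_poly 1 (\<lambda>x. x i)"
| add: "homogeneous_poly d F \<Longrightarrow> homogeneous_poly d G \<Longrightarrow> homogeneous_poly d (\<lambda>x. F x + G x)"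
| mult: "homogeneous_poly d F \<Longrightarrow> homogeneous_poly e G \<Longrightarrow>
    homogeneous_poly (d + e) (\<lambda>x. F x * G x)"

text \<open>
  Zariski open subsets of the Grassmannian, for its structure of projective variety given by the
  Pluecker embedding: the complements of the common zero loci of sets of homogeneous polynomials
  in the Pluecker coordinates.  Changing the basis \<open>b\<close> of a subspace multiplies all its
  Pluecker coordinates by a common nonzero scalar, so it is immaterial that \<open>b\<close> ranges over
  all bases.
\<close>

definition zariski_open_grassmannian :: "nat \<Rightarrow> ('n::finite) proj set set \<Rightarrow> bool" where
  "zariski_open_grassmannian m U \<longleftrightarrow> U \<subseteq> grassmannian m \<and>
     (\<exists>S. (\<forall>F\<in>S. \<exists>d. homogeneous_poly d F) \<and>
       (\<forall>b. frame m b \<longrightarrow>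
         (projectivization (vec.span (b ` {..m})) \<in> U \<longleftrightarrow> (\<exists>F\<in>S. F (plucker m b) \<noteq> 0))))"

definition generic_linear_space :: "nat \<Rightarrow> (('n::finite) proj set \<Rightarrow> bool) \<Rightarrow> bool" where
  "generic_linear_space m P \<longleftrightarrow>
     (\<exists>U. zariski_open_grassmannian m U \<and> U \<noteq> {} \<and> (\<forall>L\<in>U. P L))"

end

theory Submission
  imports Defs "HOL-Library.Multiset" "HOL-Computational_Algebra.Polynomial"
begin

text \<open>
  In a basis of \<open>L\<close>, the \<open>k\<close>-th coordinate of a point with coefficient vector \<open>x\<close> is
  \<open>\<langle>v\<^sub>k, x\<rangle>\<close> for a vector \<open>v\<^sub>k\<close> of length \<open>m + 1\<close>.  Equality of two Hadamard
  products says that the forms \<open>\<Prod>\<^sub>i \<langle>v, x\<^sub>i\<rangle>\<close> and \<open>c \<Prod>\<^sub>i \<langle>v, y\<^sub>i\<rangle>\<close> of degree \<open>r\<close> in \<open>v\<close> agree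
  at all the \<open>v\<^sub>k\<close>.  There are at least as many \<open>v\<^sub>k\<close> as monomials of degree \<open>r\<close>, so for generic \<open>L\<close> they
  impose independent conditions on forms of degree \<open>r\<close>; then the two forms are equal, and unique
  factorization gives the claim.  The genericity condition is one polynomial in the Pluecker
  coordinates, because by Cramer's rule suitably scaled \<open>v\<^sub>k\<close> are Pluecker coordinates; it is
  not identically zero because forms of degree \<open>r\<close> are determined by their values at the lattice points
  \<open>\<alpha> / r\<close> with \<open>\<bar>\<alpha>\<bar> = r\<close>.
\<close>


section \<open>Determinants and Cramer's rule for Pluecker coordinates\<close>

text \<open>The trivial-kernel criterion, phrased with plain functions and sums so that later
  arguments need no matrix carriers.\<close>

lemma det_mat_nonzero_iff:
  fixes f :: "nat \<Rightarrow> nat \<Rightarrow> complex"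
  shows "Determinant.det (Matrix.mat N N (\<lambda>(i, j). f i j)) \<noteq> 0 \<longleftrightarrow>
    (\<forall>v. (\<forall>i<N. (\<Sum>j<N. f i j * v j) = 0) \<longrightarrow> (\<forall>j<N. v j = 0))"
proof -
  let ?A = "Matrix.mat N N (\<lambda>(i, j). f i j)"
  have mult: "Matrix.vec_index (?A *\<^sub>v w) i = (\<Sum>j<N. f i j * Matrix.vec_index w j)"
    if "i < N" "w \<in> carrier_vec N" for i w
    using that by (auto simp: scalar_prod_def lessThan_atLeast0 intro!: sum.cong)
  have "Determinant.det ?A = 0 \<longleftrightarrow>
      (\<exists>w. w \<in> carrier_vec N \<and> w \<noteq> 0\<^sub>v N \<and> ?A *\<^sub>v w = 0\<^sub>v N)"
    by (rule det_0_iff_vec_prod_zero) simp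
  also have "\<dots> \<longleftrightarrow> (\<exists>v. (\<forall>i<N. (\<Sum>j<N. f i j * v j) = 0) \<and> (\<exists>j<N. v j \<noteq> 0))"
  proof (intro iffI; elim exE conjE)
    fix w :: "complex Matrix.vec"
    assume w: "w \<in> carrier_vec N" "w \<noteq> 0\<^sub>v N" and A: "?A *\<^sub>v w = 0\<^sub>v N"
    have "\<exists>j<N. Matrix.vec_index w j \<noteq> 0"
      using w by (metis carrier_vecD eq_vecI index_zero_vec(1) index_zero_vec(2))
    moreover have "(\<Sum>j<N. f i j * Matrix.vec_index w j) = 0" if "i < N" for i
      using mult[OF that w(1)] that by (simp add: A)
    ultimately show "\<exists>v. (\<forall>i<N. (\<Sum>j<N. f i j * v j) = 0) \<and> (\<exists>j<N. v j \<noteq> 0)" by blast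
  next
    fix v j assume v: "\<forall>i<N. (\<Sum>j<N. f i j * v j) = 0" and j: "j < N" "v j \<noteq> 0"
    define w where "w = Matrix.vec N v"
    have w: "w \<in> carrier_vec N" by (simp add: w_def)
    moreover have "w \<noteq> 0\<^sub>v N"
      using j by (metis index_vec index_zero_vec(1) w_def)
    moreover have "?A *\<^sub>v w = 0\<^sub>v N"
    proof (rule eq_vecI)
      fix i assume "i < dim_vec (0\<^sub>v N :: complex Matrix.vec)"
      then have i: "i < N" by simp
      have "(\<Sum>j<N. f i j * Matrix.vec_index w j) = (\<Sum>j<N. f i j * v j)"
        by (intro sum.cong) (auto simp: w_def)
      then show "Matrix.vec_index (?A *\<^sub>v w) i = Matrix.vec_index (0\<^sub>v N) i"
        using mult[OF i w] v i by simp
    qed simp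
    ultimately show "\<exists>w. w \<in> carrier_vec N \<and> w \<noteq> 0\<^sub>v N \<and> ?A *\<^sub>v w = 0\<^sub>v N" by blast
  qed
  finally show ?thesis by blast
qed

lemma det_mat_swap:
  "Determinant.det (Matrix.mat N N (\<lambda>(i, j). f j i)) =
   Determinant.det (Matrix.mat N N (\<lambda>(i, j). f i j :: 'a :: comm_ring_1))"
proof -
  have "transpose_mat (Matrix.mat N N (\<lambda>(i, j). f i j)) = Matrix.mat N N (\<lambda>(i, j). f j i)"
    by (intro eq_matI) auto
  then show ?thesis
    by (metis det_transpose mat_carrier)
qed

text \<open>Cramer's rule: by linearity in column \<open>a\<close>, every term except
  \<open>x a\<close> times the original minor has a repeated column.\<close>

lemma plucker_column_combination:
  assumes "\<And>i. i \<le> m \<Longrightarrow> b i $ k = (\<Sum>c\<le>m. b i $ J c * x c)" and "a \<le> m"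
  shows "plucker m b (J(a := k)) = x a * plucker m b J"
proof -
  let ?A = "Matrix.mat (Suc m) (Suc m) (\<lambda>(i, j). b i $ J j)"
  let ?x = "Matrix.vec (Suc m) x"
  have "Matrix.mat (Suc m) (Suc m) (\<lambda>(i, j). b i $ (J(a := k)) j) = replace_col ?A (?A *\<^sub>v ?x) a"
    using assms
    by (intro eq_matI)
      (auto simp: replace_col_def scalar_prod_def less_Suc_eq_le atLeast0_lessThan_Suc
        atLeast0LessThan lessThan_Suc_atMost simp del: sum.lessThan_Suc sum.atMost_Suc intro!: sum.cong)
  then show ?thesis
    unfolding plucker_def using cramer_lemma_mat[of ?A "Suc m" ?x a] assms(2) by simp
qed

text \<open>As the minor at \<open>J\<close> is nonzero, column \<open>k\<close> of the frame is a
  combination of the columns \<open>J c\<close>. Its coefficients are quotients of Pluecker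
  coordinates, and the relation passes from the frame to its span by linearity.\<close>

lemma plucker_cramer:
  fixes b :: "nat \<Rightarrow> complex ^ 'n::finite"
  assumes nz: "plucker m b J \<noteq> 0" and v: "v \<in> vec.span (b ` {..m})"
  shows "plucker m b J * v $ k = (\<Sum>a\<le>m. plucker m b (J(a := k)) * v $ J a)"
proof -
  let ?A = "Matrix.mat (Suc m) (Suc m) (\<lambda>(i, j). b i $ J j)"
  let ?y = "Matrix.vec (Suc m) (\<lambda>i. b i $ k)"
  have A: "?A \<in> carrier_mat (Suc m) (Suc m)" by simp
  from det_non_zero_imp_unit[OF A, of "()"] nz
  obtain B where B: "B \<in> carrier_mat (Suc m) (Suc m)" "?A * B = 1\<^sub>m (Suc m)"
    unfolding plucker_def Units_def ring_mat_def by auto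
  have "?A *\<^sub>v (B *\<^sub>v ?y) = ?y"
    using assoc_mult_mat_vec[OF A B(1), of ?y] B(2) by simp
  then have eq: "Matrix.vec_index (?A *\<^sub>v (B *\<^sub>v ?y)) i = b i $ k" if "i \<le> m" for i
    using that by simp
  define x where "x a = Matrix.vec_index (B *\<^sub>v ?y) a" for a
  have x: "b i $ k = (\<Sum>c\<le>m. b i $ J c * x c)" if "i \<le> m" for i
  proof -
    have "b i $ k = (\<Sum>c = 0..<Suc m. b i $ J c * x c)"
      unfolding eq[OF that, symmetric] using that B(1)
      by (subst index_mult_mat_vec) (auto simp: scalar_prod_def x_def simp del: sum.op_ivl_Suc
        intro!: sum.cong)
    then show ?thesis by (simp add: atLeast0LessThan lessThan_Suc_atMost)
  qed
  have pl: "plucker m b (J(a := k)) = x a * plucker m b J" if "a \<le> m" for a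
    using plucker_column_combination[OF x that] by simp
  have "v $ k = (\<Sum>c\<le>m. v $ J c * x c)"
    using v
  proof (induction rule: vec.span_induct_alt)
    case base
    then show ?case by simp
  next
    case (step c y z)
    then show ?case
      by (auto simp: x ring_distribs sum.distrib sum_distrib_left mult.assoc)
  qed
  then show ?thesis
    by (simp add: pl sum_distrib_left mult_ac)
qed

text \<open>The constant is the determinant of the matrix expressing the \<open>b i\<close> through
  the \<open>b' j\<close>; it does not depend on \<open>J\<close>.\<close>

lemma plucker_change_frame:
  fixes b b' :: "nat \<Rightarrow> complex ^ 'n::finite"
  assumes "\<And>i. i \<le> m \<Longrightarrow> b i \<in> vec.span (b' ` {..m})"
  obtains c where "\<And>J. plucker m b J = c * plucker m b' J"
proof -
  have "\<exists>t. b i = (\<Sum>j\<le>m. t j *s b' j)" if "i \<le> m" for i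
    using assms[OF that]
  proof (induction rule: vec.span_induct_alt)
    case base
    show ?case by (rule exI[of _ "\<lambda>_. 0"]) simp
  next
    case (step c x y)
    then obtain t j where t: "y = (\<Sum>j\<le>m. t j *s b' j)" and j: "j \<le> m" "x = b' j" by auto
    have "c *s x + y = (\<Sum>i\<le>m. ((if i = j then c else 0) + t i) *s b' i)"
      using j by (simp add: t vec.scale_left_distrib sum.distrib if_distrib[of "\<lambda>s. s *s _"] cong: if_cong)
    then show ?case by (rule exI[where x = "\<lambda>i. (if i = j then c else 0) + t i"])
  qed
  then obtain T where T: "\<And>i. i \<le> m \<Longrightarrow> b i = (\<Sum>j\<le>m. T i j *s b' j)" by metis
  let ?T = "Matrix.mat (Suc m) (Suc m) (\<lambda>(i, j). T i j)"
  show thesis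
  proof (rule that)
    fix J
    let ?A = "Matrix.mat (Suc m) (Suc m) (\<lambda>(i, j). b' i $ J j)"
    have "Matrix.mat (Suc m) (Suc m) (\<lambda>(i, j). b i $ J j) = ?T * ?A"
    proof (rule eq_matI)
      fix i j assume "i < dim_row (?T * ?A)" "j < dim_col (?T * ?A)"
      then show "Matrix.mat (Suc m) (Suc m) (\<lambda>(i, j). b i $ J j) $$ (i, j) = (?T * ?A) $$ (i, j)"
        by (auto simp: T less_Suc_eq_le scalar_prod_def atLeast0LessThan lessThan_Suc_atMost
          simp del: sum.lessThan_Suc sum.atMost_Suc intro!: sum.cong)
    qed auto
    then show "plucker m b J = Determinant.det ?T * plucker m b' J"
      unfolding plucker_def by (simp add: det_mult[of _ "Suc m"])
  qed
qed

section \<open>Homogeneous polynomials as functions\<close>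

lemma homogeneous_poly_scale:
  "homogeneous_poly d F \<Longrightarrow> F (\<lambda>i. c * x i) = c ^ d * F x"
  by (induction rule: homogeneous_poly.induct) (auto simp: ring_distribs power_add)

text \<open>Needed for empty sums: \<open>const\<close> gives zero in degree 0 only, and multiplying
  by a variable raises the degree.\<close>

lemma homogeneous_poly_zero: "homogeneous_poly d (\<lambda>x :: 'v \<Rightarrow> complex. 0)"
proof (induction d)
  case 0
  show ?case by (rule homogeneous_poly.const)
next
  case (Suc d)
  from homogeneous_poly.mult[OF homogeneous_poly.var[of undefined] Suc]
  show ?case by simp
qed

lemma homogeneous_poly_sum:
  "(\<And>i. i \<in> I \<Longrightarrow> homogeneous_poly d (F i)) \<Longrightarrow> homogeneous_poly d (\<lambda>x. \<Sum>i\<in>I. F i x)"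
  by (induction I rule: infinite_finite_induct) (auto intro: homogeneous_poly_zero homogeneous_poly.add)

lemma homogeneous_poly_prod:
  "(\<And>i. i \<in> I \<Longrightarrow> homogeneous_poly d (F i)) \<Longrightarrow> homogeneous_poly (card I * d) (\<lambda>x. \<Prod>i\<in>I. F i x)"
  by (induction I rule: infinite_finite_induct) (auto intro: homogeneous_poly.const homogeneous_poly.mult)

lemma homogeneous_poly_cmult:
  "homogeneous_poly d F \<Longrightarrow> homogeneous_poly d (\<lambda>x. c * F x)"
  using homogeneous_poly.mult[OF homogeneous_poly.const] by force

lemma homogeneous_poly_monomial:
  "homogeneous_poly (size M) (\<lambda>x. \<Prod>a\<in>#M. x (g a))"
proof (induction M)
  case empty
  show ?case by (simp add: homogeneous_poly.const)
next
  case (add a M)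
  from homogeneous_poly.mult[OF homogeneous_poly.var this] show ?case by simp
qed

text \<open>By the Leibniz expansion, in which the signs are constants of degree 0.\<close>

lemma homogeneous_poly_det:
  assumes "\<And>i j. i < N \<Longrightarrow> j < N \<Longrightarrow> homogeneous_poly d (F i j)"
  shows "homogeneous_poly (N * d) (\<lambda>x. Determinant.det (Matrix.mat N N (\<lambda>(i, j). F i j x)))"
proof -
  have "(\<lambda>x. Determinant.det (Matrix.mat N N (\<lambda>(i, j). F i j x))) =
      (\<lambda>x. \<Sum>p | p permutes {0..<N}. signof p * (\<Prod>i\<in>{0..<N}. F i (p i) x))"
    using permutes_in_image[of _ "{0..<N}"]
    by (auto simp: det_def'[OF mat_carrier] fun_eq_iff intro!: sum.cong prod.cong)
  moreover have "homogeneous_poly (N * d)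
      (\<lambda>x. \<Sum>p | p permutes {0..<N}. signof p * (\<Prod>i\<in>{0..<N}. F i (p i) x))"
  proof (intro homogeneous_poly_sum homogeneous_poly_cmult)
    fix p assume "p \<in> {p. p permutes {0..<N}}"
    then have "homogeneous_poly d (F i (p i))" if "i \<in> {0..<N}" for i
      using that assms permutes_in_image[of p "{0..<N}" i] by auto
    from homogeneous_poly_prod[of "{0..<N}" d "\<lambda>i. F i (p i)", OF this]
    show "homogeneous_poly (N * d) (\<lambda>x. \<Prod>i\<in>{0..<N}. F i (p i) x)" by simp
  qed
  ultimately show ?thesis by simp
qed

section \<open>Forms of degree \<open>r\<close> and their values at points\<close>

text \<open>Multiplying out gives one term for each choice function \<open>s\<close>; grouping these
  by the multiset of chosen indices collects the monomials. The coefficients depend on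
  \<open>X\<close> but not on \<open>u\<close>.\<close>

lemma prod_linear_forms_expand:
  fixes X :: "'i \<Rightarrow> 'a \<Rightarrow> 'b :: comm_semiring_1"
  assumes I: "finite I" and A: "finite A"
  obtains c where "\<And>u. (\<Prod>i\<in>I. \<Sum>a\<in>A. u a * X i a) =
    (\<Sum>M\<in>multisets_of_size A (card I). c M * (\<Prod>a\<in>#M. u a))"
proof -
  let ?g = "\<lambda>s. image_mset s (mset_set I)"
  let ?S = "PiE I (\<lambda>_. A)"
  have fin: "finite ?S" using I A by (simp add: finite_PiE)
  show thesis
  proof (rule that)
    fix u :: "'a \<Rightarrow> 'b"
    have "(\<Prod>i\<in>I. \<Sum>a\<in>A. u a * X i a) = (\<Sum>s\<in>?S. \<Prod>i\<in>I. u (s i) * X i (s i))"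
      by (rule prod_sum_PiE) (use I A in auto)
    also have "\<dots> = (\<Sum>M\<in>multisets_of_size A (card I).
        \<Sum>s\<in>{s\<in>?S. ?g s = M}. \<Prod>i\<in>I. u (s i) * X i (s i))"
      using I A by (intro sum.group[symmetric] fin)
        (auto simp: multisets_of_size_def intro: finite_multisets_of_size[unfolded multisets_of_size_def])
    also have "\<dots> = (\<Sum>M\<in>multisets_of_size A (card I).
        (\<Sum>s\<in>{s\<in>?S. ?g s = M}. \<Prod>i\<in>I. X i (s i)) * (\<Prod>a\<in>#M. u a))"
    proof (rule sum.cong[OF refl])
      fix M
      show "(\<Sum>s\<in>{s\<in>?S. ?g s = M}. \<Prod>i\<in>I. u (s i) * X i (s i)) =
        (\<Sum>s\<in>{s\<in>?S. ?g s = M}. \<Prod>i\<in>I. X i (s i)) * (\<Prod>a\<in>#M. u a)"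
        unfolding sum_distrib_right
      proof (rule sum.cong[OF refl], clarify)
        fix s
        show "(\<Prod>i\<in>I. u (s i) * X i (s i)) = (\<Prod>i\<in>I. X i (s i)) * (\<Prod>a\<in>#?g s. u a)"
          by (simp add: prod.distrib prod_unfold_prod_mset mult.commute image_mset.compositionality comp_def)
      qed
    qed
    finally show "(\<Prod>i\<in>I. \<Sum>a\<in>A. u a * X i a) = (\<Sum>M\<in>multisets_of_size A (card I).
        (\<Sum>s\<in>{s\<in>?S. ?g s = M}. \<Prod>i\<in>I. X i (s i)) * (\<Prod>a\<in>#M. u a))" .
  qed
qed
text \<open>The coefficient vector of the difference of the two forms lies in the kernel of the
  transposed matrix, hence is zero.\<close>

lemma prod_linear_forms_determined:
  fixes X Y :: "'i \<Rightarrow> 'a \<Rightarrow> complex"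
  assumes e: "bij_betw e {..<N} (multisets_of_size A r)"
    and det: "Determinant.det (Matrix.mat N N (\<lambda>(i, j). \<Prod>a\<in>#e i. v j a)) \<noteq> 0"
    and I: "finite I" "card I = r" and A: "finite A"
    and eq: "\<And>j. j < N \<Longrightarrow> (\<Prod>i\<in>I. \<Sum>a\<in>A. v j a * Y i a) = c * (\<Prod>i\<in>I. \<Sum>a\<in>A. v j a * X i a)"
  shows "(\<Prod>i\<in>I. \<Sum>a\<in>A. u a * Y i a) = c * (\<Prod>i\<in>I. \<Sum>a\<in>A. u a * X i a)"
proof -
  obtain f where f: "\<And>u. (\<Prod>i\<in>I. \<Sum>a\<in>A. u a * X i a) =
      (\<Sum>M\<in>multisets_of_size A r. f M * (\<Prod>a\<in>#M. u a))"
    using prod_linear_forms_expand[OF I(1) A, of X] I(2) by metis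
  obtain g where g: "\<And>u. (\<Prod>i\<in>I. \<Sum>a\<in>A. u a * Y i a) =
      (\<Sum>M\<in>multisets_of_size A r. g M * (\<Prod>a\<in>#M. u a))"
    using prod_linear_forms_expand[OF I(1) A, of Y] I(2) by metis
  define h where "h M = g M - c * f M" for M
  have diff: "(\<Prod>i\<in>I. \<Sum>a\<in>A. u a * Y i a) - c * (\<Prod>i\<in>I. \<Sum>a\<in>A. u a * X i a) =
      (\<Sum>i<N. (\<Prod>a\<in>#e i. u a) * h (e i))" for u
    unfolding f g h_def sum.reindex_bij_betw[OF e, symmetric]
    by (simp add: sum_subtractf[symmetric] sum_distrib_left algebra_simps)
  have "h (e i) = 0" if "i < N" for i
  proof -
    have "\<forall>j<N. (\<Sum>i<N. (\<Prod>a\<in>#e i. v j a) * h (e i)) = 0"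
      using eq by (simp flip: diff)
    then have "\<forall>i<N. h (e i) = 0"
      using det[unfolded det_mat_swap[of N "\<lambda>j i. \<Prod>a\<in>#e i. v j a"] det_mat_nonzero_iff,
        rule_format, of "\<lambda>i. h (e i)"] by simp
    then show ?thesis using that by blast
  qed
  then show ?thesis using diff[of u] by simp
qed

text \<open>A kernel vector \<open>v\<close> is a linear relation between evaluations at the lattice
  points that holds for all monomials of degree \<open>r\<close>, hence for all their combinations.
  Applied to a form that vanishes at every lattice point but one, it forces
  \<open>v l = 0\<close>.\<close>

lemma det_monomials_lattice_nonzero:
  assumes e: "bij_betw e {..<N} (multisets_of_size A r)" and A: "finite A" and r: "r > 0"
  shows "Determinant.det (Matrix.mat N N
    (\<lambda>(i, j). \<Prod>a\<in>#e i. of_nat (count (e j) a) / of_nat r :: complex)) \<noteq> 0"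
  unfolding det_mat_nonzero_iff
proof (intro allI impI)
  define pt where "pt j a = (of_nat (count (e j) a) / of_nat r :: complex)" for j a
  fix v :: "nat \<Rightarrow> complex" and l
  assume v: "\<forall>i<N. (\<Sum>j<N. (\<Prod>a\<in>#e i. of_nat (count (e j) a) / of_nat r) * v j) = 0"
    and l: "l < N"
  have e_mem: "set_mset (e j) \<subseteq> A" "size (e j) = r" if "j < N" for j
    using bij_betwE[OF e] that by (auto simp: multisets_of_size_def)
  have size: "(\<Sum>a\<in>A. count (e j) a) = r" if "j < N" for j
  proof -
    have "r = (\<Sum>a\<in>set_mset (e j). count (e j) a)"
      using e_mem(2)[OF that] by (simp add: size_multiset_overloaded_eq)
    also have "\<dots> = (\<Sum>a\<in>A. count (e j) a)"
      using e_mem(1)[OF that] A by (intro sum.mono_neutral_left) (auto simp: not_in_iff)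
    finally show ?thesis by simp
  qed
  txt \<open>
    The form \<open>f\<close> below is \<open>\<Prod>\<^sub>a \<Prod>\<^bsub>s < count (e l) a\<^esub> (x\<^sub>a - (s / r) \<Sum>\<^sub>d x\<^sub>d)\<close>; it vanishes at all
    lattice points except the \<open>l\<close>-th one.
  \<close>
  define I where "I = (SIGMA a:A. {..<count (e l) a})"
  have I: "finite I" "card I = r"
    using size[OF l] A by (simp_all add: I_def)
  define Y :: "'a \<times> nat \<Rightarrow> 'a \<Rightarrow> complex"
    where "Y = (\<lambda>(a, s) d. (if d = a then 1 else 0) - of_nat s / of_nat r)"
  have Y: "(\<Sum>d\<in>A. pt j d * Y (a, s) d) = (of_nat (count (e j) a) - of_nat s) / of_nat r"
    if "j < N" "a \<in> A" for j a s
  proof -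
    \<comment> \<open>On the plane where the coordinates sum to 1, the homogeneous correction term
      in \<open>Y\<close> equals the constant \<open>s / r\<close>.\<close>
    have "(\<Sum>d\<in>A. pt j d) = 1"
      using size[OF that(1)] r by (simp add: pt_def sum_divide_distrib[symmetric] flip: of_nat_sum)
    then have "(\<Sum>d\<in>A. pt j d * Y (a, s) d) = pt j a - of_nat s / of_nat r"
      using that(2) A
      by (simp add: Y_def right_diff_distrib sum_subtractf sum_distrib_right[symmetric]
        sum_divide_distrib[symmetric] if_distrib[of "\<lambda>t. _ * t"] cong: if_cong)
    then show ?thesis by (simp add: pt_def diff_divide_distrib)
  qed
  define f where "f j = (\<Prod>i\<in>I. \<Sum>d\<in>A. pt j d * Y i d)" for j
  have f: "f j = (\<Prod>(a, s)\<in>I. (of_nat (count (e j) a) - of_nat s) / of_nat r)" if "j < N" for j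
    unfolding f_def by (intro prod.cong refl) (auto simp: Y[OF that] I_def)
  have "f l \<noteq> 0"
    unfolding f[OF l] using I(1) r by (auto simp: prod_zero_iff I_def)
  moreover have "f j = 0" if j: "j < N" "j \<noteq> l" for j
  proof -
    have "e j \<noteq> e l"
      using e j l by (auto simp: bij_betw_def inj_on_def)
    \<comment> \<open>Both multisets have size \<open>r\<close>, so neither of two distinct ones
      contains the other. The factor with \<open>s = count (e j) a\<close> then vanishes at
      \<open>pt j\<close>.\<close>
    then obtain a where a: "count (e j) a < count (e l) a"
      using e_mem(2)[OF j(1)] e_mem(2)[OF l]
      by (metis mset_subset_eqI mset_subset_size nless_le not_le_imp_less subset_mset.less_le)
    then have "a \<in> A" using e_mem(1)[OF l] by (metis not_less_zero subset_iff not_in_iff)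
    with a have "(a, count (e j) a) \<in> I" by (simp add: I_def)
    then show ?thesis
      unfolding f[OF j(1)] using I(1) by (force simp: prod_zero_iff)
  qed
  moreover have "(\<Sum>j<N. f j * v j) = 0"
  proof -
    obtain c where c: "\<And>u. (\<Prod>i\<in>I. \<Sum>a\<in>A. u a * Y i a) =
        (\<Sum>M\<in>multisets_of_size A r. c M * (\<Prod>a\<in>#M. u a))"
      using prod_linear_forms_expand[OF I(1) A, of Y] I(2) by metis
    have "(\<Sum>j<N. f j * v j) = (\<Sum>j<N. \<Sum>i<N. c (e i) * ((\<Prod>a\<in>#e i. pt j a) * v j))"
      unfolding f_def c sum.reindex_bij_betw[OF e, symmetric] by (simp add: sum_distrib_right mult.assoc)
    also have "\<dots> = (\<Sum>i<N. c (e i) * (\<Sum>j<N. (\<Prod>a\<in>#e i. pt j a) * v j))"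
      by (subst sum.swap) (simp add: sum_distrib_left)
    also have "\<dots> = 0"
      using v by (simp add: pt_def)
    finally show ?thesis .
  qed
  moreover have "(\<Sum>j<N. f j * v j) = f l * v l"
    using l calculation(2) by (subst sum.remove[of _ l]) auto
  ultimately show "v l = 0" by simp
qed

section \<open>Unique factorization of products of linear forms\<close>

text \<open>Take \<open>u\<close> on the moment curve \<open>(1, t, ..., t^m)\<close>: each
  \<open>z\<close> gives a nonzero polynomial in \<open>t\<close>, and finitely many of these have
  only finitely many roots.\<close>

lemma exists_off_hyperplanes:
  fixes Z :: "(nat \<Rightarrow> complex) set"
  assumes "finite Z" and nz: "\<And>z. z \<in> Z \<Longrightarrow> \<exists>a\<le>m. z a \<noteq> 0"
  obtains u where "\<And>z. z \<in> Z \<Longrightarrow> (\<Sum>a\<le>m. u a * z a) \<noteq> 0"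
proof -
  define P where "P z = (\<Sum>a\<le>m. monom (z a) a)" for z :: "nat \<Rightarrow> complex"
  have "P z \<noteq> 0" if z: "z \<in> Z" for z
  proof -
    from nz[OF z] obtain a where "a \<le> m" "z a \<noteq> 0" by blast
    then have "Polynomial.coeff (P z) a \<noteq> 0" by (simp add: P_def coeff_sum)
    then show ?thesis by auto
  qed
  then have "(\<Prod>z\<in>Z. P z) \<noteq> 0" using \<open>finite Z\<close> by simp
  then have "finite {t. poly (\<Prod>z\<in>Z. P z) t = 0}" by (rule poly_roots_finite)
  then obtain t where t: "poly (\<Prod>z\<in>Z. P z) t \<noteq> 0"
    using ex_new_if_finite[OF infinite_UNIV_char_0] by blast
  show thesis
  proof (rule that)
    fix z assume "z \<in> Z"
    then show "(\<Sum>a\<le>m. t ^ a * z a) \<noteq> 0"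
      using t \<open>finite Z\<close> by (simp add: poly_prod P_def poly_sum poly_monom mult.commute)
  qed
qed

lemma proots_prod_linear:
  fixes f g :: "'i \<Rightarrow> 'a :: field"
  assumes "\<And>i. i \<in> I \<Longrightarrow> g i \<noteq> 0" "finite I"
  shows "proots (\<Prod>i\<in>I. [:f i, g i:]) = image_mset (\<lambda>i. - (f i / g i)) (mset_set I)"
proof -
  have "proots [:f i, g i:] = {#- (f i / g i)#}" if "i \<in> I" for i
  proof -
    have "[:f i, g i:] = Polynomial.smult (g i) [:f i / g i, 1:]" using assms(1)[OF that] by simp
    then show ?thesis using assms(1)[OF that] by (simp del: smult_pCons)
  qed
  then have "proots (\<Prod>i\<in>I. [:f i, g i:]) = (\<Sum>i\<in>I. {#- (f i / g i)#})"
    using assms(1) by (subst proots_prod) auto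
  also have "\<dots> = image_mset (\<lambda>i. - (f i / g i)) (mset_set I)"
    using \<open>finite I\<close> by induction auto
  finally show ?thesis .
qed

lemma image_mset_cancel_left:
  assumes inj: "inj_on g (set_mset A \<union> set_mset B)" and eq: "image_mset g A = image_mset g B"
  shows "A = B"
proof -
  let ?h = "inv_into (set_mset A \<union> set_mset B) g"
  have "image_mset (?h \<circ> g) C = C" if "set_mset C \<subseteq> set_mset A \<union> set_mset B" for C
    using that inj by (subst image_mset_cong[where g = id]) (auto simp: subset_iff)
  then show ?thesis
    using arg_cong[OF eq, of "image_mset ?h"] by (simp add: image_mset.compositionality)
qed

text \<open>
  Restricting to a general line \<open>t \<mapsto> u + t w\<close>, the roots of the product determine its factors.
\<close>

lemma linear_forms_unique:
  fixes X :: "'p \<Rightarrow> nat \<Rightarrow> complex" and m :: nat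
  defines "form \<equiv> \<lambda>u s. \<Sum>a\<le>m. u a * X s a"
  assumes I: "finite I"
    and nz: "\<And>s. s \<in> p ` I \<union> q ` I \<Longrightarrow> \<exists>a\<le>m. X s a \<noteq> 0"
    and dist: "\<And>s t \<alpha> \<beta>. \<lbrakk>s \<in> p ` I \<union> q ` I; t \<in> p ` I \<union> q ` I; \<alpha> \<noteq> 0; \<beta> \<noteq> 0;
      \<And>a. a \<le> m \<Longrightarrow> \<alpha> * X s a = \<beta> * X t a\<rbrakk> \<Longrightarrow> s = t"
    and c: "c \<noteq> 0"
    and eq: "\<And>u. (\<Prod>i\<in>I. form u (q i)) = c * (\<Prod>i\<in>I. form u (p i))"
  shows "image_mset p (mset_set I) = image_mset q (mset_set I)"
proof -
  let ?S = "p ` I \<union> q ` I"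
  have fin: "finite ?S" using I by simp
  \<comment> \<open>With this direction every form restricted to the line has degree exactly one in
    \<open>t\<close>, so it has a root.\<close>
  obtain w where w: "\<And>s. s \<in> ?S \<Longrightarrow> form w s \<noteq> 0"
  proof (rule exists_off_hyperplanes[of "X ` ?S" m])
    show "finite (X ` ?S)" using fin by blast
  next
    fix z assume "z \<in> X ` ?S"
    then show "\<exists>a\<le>m. z a \<noteq> 0" using nz by blast
  next
    fix w assume "\<And>z. z \<in> X ` ?S \<Longrightarrow> (\<Sum>a\<le>m. w a * z a) \<noteq> 0"
    then show thesis by (intro that[of w]) (auto simp: form_def)
  qed
  \<comment> \<open>The roots of \<open>s\<close> and \<open>t\<close> on the line coincide iff the
    form with coefficients \<open>Z s t\<close> vanishes at \<open>u\<close>. Choosing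
    \<open>u\<close> off the hyperplanes of the nonzero \<open>Z s t\<close> leaves only
    \<open>Z s t = 0\<close>, which makes \<open>X s\<close> and \<open>X t\<close>
    proportional.\<close>
  define Z where "Z s t = (\<lambda>a. form w t * X s a - form w s * X t a)" for s t
  obtain u where u: "\<And>z. z \<in> {z \<in> case_prod Z ` (?S \<times> ?S). \<exists>a\<le>m. z a \<noteq> 0} \<Longrightarrow> (\<Sum>a\<le>m. u a * z a) \<noteq> 0"
    using exists_off_hyperplanes[of "{z \<in> case_prod Z ` (?S \<times> ?S). \<exists>a\<le>m. z a \<noteq> 0}" m] fin
    by fastforce
  define g where "g s = - (form u s / form w s)" for s
  have form_u: "form u s = (\<Sum>a\<le>m. u a * X s a)" for s by (simp add: form_def)
  have inj: "inj_on g ?S"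
  proof (rule inj_onI)
    fix s t assume st: "s \<in> ?S" "t \<in> ?S" and "g s = g t"
    then have "form w t * form u s - form w s * form u t = 0"
      using w[OF st(1)] w[OF st(2)] by (simp add: g_def field_simps)
    also have "form w t * form u s - form w s * form u t = (\<Sum>a\<le>m. u a * Z s t a)"
      by (simp add: form_u Z_def sum_distrib_left right_diff_distrib sum_subtractf mult_ac)
    finally have "\<forall>a\<le>m. Z s t a = 0"
      using u[of "Z s t"] st by (auto simp: image_iff)
    then show "s = t"
      by (intro dist[OF st w[OF st(2)] w[OF st(1)]]) (simp add: Z_def)
  qed
  define P where "P h = (\<Prod>i\<in>I. [:form u (h i), form w (h i):])" for h :: "_ \<Rightarrow> 'p"
  have P: "poly (P h) t = (\<Prod>i\<in>I. form (\<lambda>a. u a + t * w a) (h i))" for h t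
    by (simp add: P_def poly_prod form_def ring_distribs sum.distrib sum_distrib_left mult_ac)
  have "poly (P q) = poly (Polynomial.smult c (P p))"
    by (auto simp: P eq)
  then have "P q = Polynomial.smult c (P p)" by (simp only: poly_eq_poly_eq_iff)
  then have "proots (P q) = proots (P p)" using c by simp
  moreover have "proots (P p) = image_mset g (image_mset p (mset_set I))"
    unfolding P_def using w I
    by (subst proots_prod_linear) (auto simp: g_def image_mset.compositionality comp_def)
  moreover have "proots (P q) = image_mset g (image_mset q (mset_set I))"
    unfolding P_def using w I
    by (subst proots_prod_linear) (auto simp: g_def image_mset.compositionality comp_def)
  ultimately show ?thesis
    using inj I by (intro image_mset_cancel_left[of g]) auto
qed

section \<open>Uniqueness on a single linear space\<close>

text \<open>
  If \<open>x\<close> is the vector of Pluecker coordinates and \<open>x J \<noteq> 0\<close>, then \<open>a \<mapsto> x (J(a := k))\<close> is \<open>x J\<close> times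
  the coefficient vector of the \<open>k\<close>-th coordinate with respect to the coordinates \<open>J 0, \<dots>, J m\<close>.
  The determinant expresses that the points belonging to the coordinates \<open>K j\<close> impose independent
  conditions on the forms spanned by the monomials \<open>e i\<close>.
\<close>

definition unisolvence_form ::
  "nat \<Rightarrow> (nat \<Rightarrow> nat multiset) \<Rightarrow> (nat \<Rightarrow> 'n) \<Rightarrow> (nat \<Rightarrow> 'n) \<Rightarrow> ((nat \<Rightarrow> 'n) \<Rightarrow> complex) \<Rightarrow> complex"
  where "unisolvence_form N e J K x =
    x J * Determinant.det (Matrix.mat N N (\<lambda>(i, j). \<Prod>a\<in>#e i. x (J(a := K j))))"

lemma homogeneous_poly_unisolvence_form:
  assumes "\<And>i. i < N \<Longrightarrow> size (e i) = r"
  shows "homogeneous_poly (1 + N * r) (unisolvence_form N e J K)"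
proof -
  have "homogeneous_poly r (\<lambda>x. \<Prod>a\<in>#e i. x (J(a := K j)))" if "i < N" for i j
    using homogeneous_poly_monomial[of "e i" "\<lambda>a. J(a := K j)"] assms[OF that] by simp
  then have "homogeneous_poly (N * r)
      (\<lambda>x. Determinant.det (Matrix.mat N N (\<lambda>(i, j). \<Prod>a\<in>#e i. x (J(a := K j)))))"
    by (rule homogeneous_poly_det)
  from homogeneous_poly.mult[OF homogeneous_poly.var[of J] this] show ?thesis
    unfolding unisolvence_form_def[abs_def] .
qed

lemma rep_proj_in_subspace:
  assumes "vec.subspace W" "s \<in> projectivization W"
  shows "rep_proj s \<in> W"
proof -
  from assms(2) obtain v where v: "s = proj v" "v \<in> W" "v \<noteq> 0"
    unfolding projectivization_def by blast
  then have "proj v = proj (rep_proj s)" by simp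
  then obtain c where "rep_proj s = c *s v"
    using proj_eq_iff[OF v(3) rep_proj_nonzero] by blast
  then show ?thesis using v(2) assms(1) by (simp add: vec.subspace_scale)
qed

lemma projectivization_mono_iff:
  assumes W: "vec.subspace W" and W': "vec.subspace W'"
  shows "projectivization W \<subseteq> projectivization W' \<longleftrightarrow> W \<subseteq> W'"
proof
  assume sub: "projectivization W \<subseteq> projectivization W'"
  show "W \<subseteq> W'"
  proof
    fix v assume v: "v \<in> W"
    show "v \<in> W'"
    proof (cases "v = 0")
      case True
      then show ?thesis using W' by (simp add: vec.subspace_0)
    next
      case False
      then have "proj v \<in> projectivization W'"
        using v sub unfolding projectivization_def by blast
      then have rep: "rep_proj (proj v) \<in> W'" by (rule rep_proj_in_subspace[OF W'])
      obtain c where "v = c *s rep_proj (proj v)"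
        using proj_eq_iff[OF rep_proj_nonzero False, of "proj v"] by auto
      then show ?thesis using rep W' by (metis vec.subspace_scale)
    qed
  qed
qed (auto simp: projectivization_def)

lemma hadamard_prod_unique:
  fixes b :: "nat \<Rightarrow> complex ^ 'n::finite" and p q :: "'i \<Rightarrow> 'n proj"
  assumes e: "bij_betw e {..<N} (multisets_of_size {..m} r)"
    and nz: "unisolvence_form N e J K (plucker m b) \<noteq> 0"
    and I: "finite I" "card I = r"
    and p: "\<And>i. i \<in> I \<Longrightarrow> p i \<in> projectivization (vec.span (b ` {..m}))"
    and q: "\<And>i. i \<in> I \<Longrightarrow> q i \<in> projectivization (vec.span (b ` {..m}))"
    and pq: "hadamard_prod I p \<noteq> None" "hadamard_prod I p = hadamard_prod I q"
  shows "image_mset p (mset_set I) = image_mset q (mset_set I)"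
proof -
  define D where "D = plucker m b J"
  define v where "v k a = plucker m b (J(a := k))" for k a
  define X where "X s a = rep_proj s $ J a" for s :: "'n proj" and a
  from nz have D: "D \<noteq> 0"
    and det: "Determinant.det (Matrix.mat N N (\<lambda>(i, j). \<Prod>a\<in>#e i. v (K j) a)) \<noteq> 0"
    by (simp_all add: unisolvence_form_def D_def v_def)
  let ?S = "p ` I \<union> q ` I"
  have X: "D * rep_proj s $ k = (\<Sum>a\<le>m. v k a * X s a)" if "s \<in> ?S" for s k
  proof -
    have "rep_proj s \<in> vec.span (b ` {..m})"
      using that p q by (auto intro!: rep_proj_in_subspace)
    then show ?thesis
      using plucker_cramer[of m b J _ k] D by (simp add: D_def v_def X_def)
  qed
  define V W where "V = (\<chi> k. \<Prod>i\<in>I. rep_proj (p i) $ k)" and "W = (\<chi> k. \<Prod>i\<in>I. rep_proj (q i) $ k)"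
  have VW: "V \<noteq> 0" "W \<noteq> 0" "proj V = proj W"
    using pq by (auto simp: hadamard_prod_def Let_def V_def[symmetric] W_def[symmetric] split: if_splits)
  then obtain c where c: "W = c *s V" using proj_eq_iff by blast
  then have "c \<noteq> 0" using VW by auto
  have prod: "(\<Prod>i\<in>I. rep_proj (q i) $ k) = c * (\<Prod>i\<in>I. rep_proj (p i) $ k)" for k
    using arg_cong[OF c, of "\<lambda>x. x $ k"] by (simp add: V_def W_def)
  \<comment> \<open>The factor \<open>D ^ r\<close> is the same for \<open>p\<close> and
    \<open>q\<close>, so \<open>prod\<close> becomes a relation between products of linear forms
    evaluated at \<open>v k\<close>.\<close>
  have scaled: "(\<Prod>i\<in>I. \<Sum>a\<le>m. v k a * X (h i) a) = D ^ r * (\<Prod>i\<in>I. rep_proj (h i) $ k)"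
    if "h ` I \<subseteq> ?S" for h k
  proof -
    have "(\<Prod>i\<in>I. \<Sum>a\<le>m. v k a * X (h i) a) = (\<Prod>i\<in>I. D * rep_proj (h i) $ k)"
      using that by (intro prod.cong refl X[symmetric]) auto
    then show ?thesis using I by (simp add: prod.distrib)
  qed
  have agree: "(\<Prod>i\<in>I. \<Sum>a\<le>m. u a * X (q i) a) = c * (\<Prod>i\<in>I. \<Sum>a\<le>m. u a * X (p i) a)" for u
    by (rule prod_linear_forms_determined[OF e det I]) (simp_all add: scaled prod)
  show ?thesis
  proof (rule linear_forms_unique[OF I(1) _ _ \<open>c \<noteq> 0\<close> agree])
    fix s assume s: "s \<in> ?S"
    \<comment> \<open>A vector of the span is determined by its coordinates at
      \<open>J 0, ..., J m\<close>, so these cannot all vanish.\<close>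
    show "\<exists>a\<le>m. X s a \<noteq> 0"
    proof (rule ccontr)
      assume "\<not> ?thesis"
      then have "rep_proj s $ k = 0" for k using X[OF s, of k] D by simp
      then show False using rep_proj_nonzero[of s] by (simp add: Finite_Cartesian_Product.vec_eq_iff)
    qed
  next
    fix s t and \<alpha> \<beta> :: complex
    assume st: "s \<in> ?S" "t \<in> ?S" and nz: "\<alpha> \<noteq> 0" "\<beta> \<noteq> 0"
      and eq: "\<And>a. a \<le> m \<Longrightarrow> \<alpha> * X s a = \<beta> * X t a"
    have "D * (\<alpha> * rep_proj s $ k) = D * (\<beta> * rep_proj t $ k)" for k
    proof -
      have "D * (\<alpha> * rep_proj s $ k) = \<alpha> * (D * rep_proj s $ k)" by simp
      also have "\<dots> = (\<Sum>a\<le>m. v k a * (\<alpha> * X s a))"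
        by (simp only: X[OF st(1)] sum_distrib_left mult.left_commute)
      also have "\<dots> = (\<Sum>a\<le>m. v k a * (\<beta> * X t a))" by (simp add: eq)
      also have "\<dots> = \<beta> * (D * rep_proj t $ k)"
        by (simp only: X[OF st(2)] sum_distrib_left mult.left_commute)
      also have "\<dots> = D * (\<beta> * rep_proj t $ k)" by simp
      finally show ?thesis .
    qed
    then have "rep_proj t = (\<alpha> / \<beta>) *s rep_proj s"
      using D nz by (simp add: Finite_Cartesian_Product.vec_eq_iff field_simps)
    then have "proj (rep_proj s) = proj (rep_proj t)"
      using proj_eq_iff[OF rep_proj_nonzero rep_proj_nonzero] by blast
    then show "s = t" by simp
  qed
qed

section \<open>Zariski openness of the nonvanishing locus\<close>

text \<open>The Pluecker vectors are proportional, so homogeneity gives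
  \<open>F (plucker m b) = c ^ d * F (plucker m b')\<close>.\<close>

lemma nonvanishing_frame_indep:
  fixes b b' :: "nat \<Rightarrow> complex ^ 'n::finite"
  assumes "homogeneous_poly d F" "F (plucker m b) \<noteq> 0"
    and "projectivization (vec.span (b ` {..m})) = projectivization (vec.span (b' ` {..m}))"
  shows "F (plucker m b') \<noteq> 0"
proof -
  have "vec.span (b ` {..m}) \<subseteq> vec.span (b' ` {..m})"
    using assms(3) by (subst projectivization_mono_iff[symmetric]) auto
  then have "b i \<in> vec.span (b' ` {..m})" if "i \<le> m" for i
    using that vec.span_base[of "b i" "b ` {..m}"] by auto
  then obtain c where "plucker m b J = c * plucker m b' J" for J
    using plucker_change_frame by blast
  then have "plucker m b = (\<lambda>J. c * plucker m b' J)" by blast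
  then show ?thesis
    using assms(2) homogeneous_poly_scale[OF assms(1)] by auto
qed

text \<open>Openness tests every frame of a space while the set asks for one good frame;
  independence of the frame bridges the two.\<close>

lemma zariski_open_grassmannian_nonzero_locus:
  fixes F :: "((nat \<Rightarrow> 'n::finite) \<Rightarrow> complex) \<Rightarrow> complex"
  assumes F: "homogeneous_poly d F"
  shows "zariski_open_grassmannian m
    {projectivization (vec.span (b ` {..m})) | b. frame m b \<and> F (plucker m b) \<noteq> 0}"
  unfolding zariski_open_grassmannian_def
proof (intro conjI exI[of _ "{F}"])
  have "vec.dim (vec.span (b ` {..m})) = Suc m" if "frame m b" for b :: "nat \<Rightarrow> complex ^ 'n"
    using that by (simp add: frame_def vec.dim_eq_card_independent card_image)
  then show "{projectivization (vec.span (b ` {..m})) | b. frame m b \<and> F (plucker m b) \<noteq> 0}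
      \<subseteq> grassmannian m"
    unfolding grassmannian_def using vec.subspace_span by blast
qed (use F in \<open>auto dest: nonvanishing_frame_indep[OF F]\<close>)

section \<open>Normalized frames and existence of a good space\<close>

text \<open>Reading a linear relation at coordinate \<open>J a\<close> isolates the coefficient of
  \<open>b a\<close>.\<close>

lemma biorthogonal_frame:
  fixes b :: "nat \<Rightarrow> complex ^ 'n::finite"
  assumes "\<And>i a. i \<le> m \<Longrightarrow> a \<le> m \<Longrightarrow> b i $ J a = (if a = i then 1 else 0)"
  shows "frame m b"
  unfolding frame_def
proof
  show inj: "inj_on b {..m}"
    by (rule inj_onI) (metis assms atMost_iff zero_neq_one)
  show "vec.independent (b ` {..m})"
  proof (rule vec.independent_if_scalars_zero)
    fix f x assume 0: "(\<Sum>x\<in>b ` {..m}. f x *s x) = 0" and "x \<in> b ` {..m}"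
    then obtain a where a: "a \<le> m" "x = b a" by auto
    have "0 = (\<Sum>i\<le>m. f (b i) *s b i) $ J a"
      using 0 by (simp add: sum.reindex[OF inj])
    also have "\<dots> = (\<Sum>i\<le>m. if a = i then f (b i) else 0)"
      unfolding sum_component using a(1) by (intro sum.cong) (auto simp: assms)
    finally show "f x = 0" using a by simp
  qed simp
qed

text \<open>The minor at \<open>J\<close> is that of the identity matrix, so column \<open>k\<close>
  has the entries \<open>b c $ k\<close> as its own coefficients.\<close>

lemma plucker_biorthogonal:
  fixes b :: "nat \<Rightarrow> complex ^ 'n::finite"
  assumes b: "\<And>i a. i \<le> m \<Longrightarrow> a \<le> m \<Longrightarrow> b i $ J a = (if a = i then 1 else 0)"
  shows "plucker m b J = 1" and "a \<le> m \<Longrightarrow> plucker m b (J(a := k)) = b a $ k"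
proof -
  have "Matrix.mat (Suc m) (Suc m) (\<lambda>(i, j). b i $ J j) = 1\<^sub>m (Suc m)"
    by (intro eq_matI) (auto simp: b)
  then show *: "plucker m b J = 1" by (simp add: plucker_def)
  have "b i $ k = (\<Sum>c\<le>m. b i $ J c * b c $ k)" if "i \<le> m" for i
    using that by (simp add: b if_distrib[of "\<lambda>t. t * _"] cong: if_cong)
  then show "plucker m b (J(a := k)) = b a $ k" if "a \<le> m"
    using plucker_column_combination[of m b k J "\<lambda>c. b c $ k" a] that * by simp
qed

theorem corollary6p5:
  fixes m r n :: nat
  assumes "r \<ge> 1"
    and "CARD('n::finite) = n + 1"
    and "n \<ge> ((m + r) choose r) - 1"
  shows "generic_linear_space m (\<lambda>L :: 'n proj set.
    \<forall>p q :: nat \<Rightarrow> 'n proj.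
      (\<forall>i\<in>{1..r}. p i \<in> L) \<longrightarrow> (\<forall>j\<in>{1..r}. q j \<in> L) \<longrightarrow>
      hadamard_prod {1..r} p \<noteq> None \<longrightarrow>
      hadamard_prod {1..r} p = hadamard_prod {1..r} q \<longrightarrow>
      image_mset p (mset_set {1..r}) = image_mset q (mset_set {1..r}))"
proof -
  let ?M = "multisets_of_size {..m} r"
  define N where "N = card ?M"
  have fin: "finite ?M" by auto
  then obtain e where e: "bij_betw e {..<N} ?M"
    using ex_bij_betw_nat_finite[of ?M] by (auto simp: N_def atLeast0LessThan)
  have "card ?M = (m + r) choose r"
    using assms(1) by (simp add: card_multisets_of_size)
  then have "card ?M \<le> CARD('n)" using assms(2,3) by linarith
  \<comment> \<open>The bound on \<open>n\<close> lets every lattice point, encoded as a multiset,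
    have a coordinate of its own.\<close>
  then obtain K' where K': "inj_on K' ?M" "K' ` ?M \<subseteq> (UNIV :: 'n set)"
    using card_le_inj[OF fin finite[of UNIV]] by blast
  txt \<open>
    The vertices \<open>r e\<^sub>a\<close> of the lattice simplex give the coordinates \<open>J a\<close>, so the basis \<open>b\<close> of
    the witness below is already normalized there.
  \<close>
  define K where "K = K' \<circ> e"
  define J where "J = (\<lambda>a. K' (replicate_mset r a))"
  define F where "F = unisolvence_form N e J K"
  have e_mem: "e i \<in> ?M" if "i < N" for i
    using bij_betwE[OF e] that by auto
  have hom: "homogeneous_poly (1 + N * r) F"
    unfolding F_def using e_mem
    by (intro homogeneous_poly_unisolvence_form) (auto simp: multisets_of_size_def)
  define U where
    "U = {projectivization (vec.span (b ` {..m})) | b :: nat \<Rightarrow> complex ^ 'n.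
      frame m b \<and> F (plucker m b) \<noteq> 0}"
  \<comment> \<open>The witness: column \<open>K' M\<close> of the frame is the lattice point
    \<open>M / r\<close>. Outside the image of \<open>K'\<close> the value of
    \<open>inv_into\<close> is unspecified; only columns in the image enter
    \<open>F\<close>.\<close>
  define b :: "nat \<Rightarrow> complex ^ 'n" where
    "b = (\<lambda>a. \<chi> k. of_nat (count (inv_into ?M K' k) a) / of_nat r)"
  have b_K': "b a $ K' M = of_nat (count M a) / of_nat r" if "M \<in> ?M" for a M
    using that K'(1) by (simp add: b_def)
  have b_J: "b i $ J a = (if a = i then 1 else 0)" if "i \<le> m" "a \<le> m" for i a
    unfolding J_def using that assms(1) by (subst b_K') (auto simp: multisets_of_size_def)
  \<comment> \<open>At the witness the entries become monomials evaluated at lattice points, so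
    \<open>det_monomials_lattice_nonzero\<close> applies.\<close>
  have "(\<Prod>a\<in>#e i. plucker m b (J(a := K j))) = (\<Prod>a\<in>#e i. of_nat (count (e j) a) / of_nat r)"
    if ij: "i < N" "j < N" for i j
  proof (intro arg_cong[of _ _ prod_mset] image_mset_cong)
    fix a assume "a \<in># e i"
    then have "a \<le> m" using e_mem[OF ij(1)] by (auto simp: multisets_of_size_def)
    then show "plucker m b (J(a := K j)) = of_nat (count (e j) a) / of_nat r"
      using plucker_biorthogonal(2)[of m b J a "K j"] b_J b_K'[OF e_mem[OF ij(2)]] by (simp add: K_def)
  qed
  then have "Matrix.mat N N (\<lambda>(i, j). \<Prod>a\<in>#e i. plucker m b (J(a := K j))) =
      Matrix.mat N N (\<lambda>(i, j). \<Prod>a\<in>#e i. of_nat (count (e j) a) / of_nat r)"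
    by (intro eq_matI) auto
  then have "F (plucker m b) \<noteq> 0"
    using det_monomials_lattice_nonzero[OF e] assms(1) plucker_biorthogonal(1)[of m b J] b_J
    by (simp add: F_def unisolvence_form_def)
  moreover have "frame m b" using b_J by (rule biorthogonal_frame)
  ultimately have "U \<noteq> {}" unfolding U_def by blast
  moreover have "zariski_open_grassmannian m U"
    unfolding U_def by (rule zariski_open_grassmannian_nonzero_locus[OF hom])
  moreover have "image_mset p (mset_set {1..r}) = image_mset q (mset_set {1..r})"
    if "L \<in> U" "\<forall>i\<in>{1..r}. p i \<in> L" "\<forall>j\<in>{1..r}. q j \<in> L"
      "hadamard_prod {1..r} p \<noteq> None" "hadamard_prod {1..r} p = hadamard_prod {1..r} q"
    for L and p q :: "nat \<Rightarrow> 'n proj"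
    using that hadamard_prod_unique[OF e, of J K _ "{1..r}" p q] by (auto simp: U_def F_def)
  ultimately show ?thesis
    unfolding generic_linear_space_def by blast
qed

end
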